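(* Let $p\geq 5$ be a prime number, and let $F_p\cong \mathbb Z_p\rtimes\mathbb Z_{p-1}$ denote the Frobenius group of order $p(p-1)$. Then $\iota(F_p)=2$ and $$\hat\iota(F_p)=\begin{cases} k+1 & \text{if } p-1 \text{ is a square-free integer},\\ \infty & \text{otherwise},\end{cases}$$ where $k$ is the number of distinct prime divisors of $p-1$.
   Context: For a prime $p\geq 5$ and $r\in\mathbb Z_p^\times$ of order $p-1$, the Frobenius group $F_p$ is defined by the presentation $F_p=\langle x,y : x^p=1=y^{p-1},\ y^{-1}xy=x^r\rangle$; it has order $p(p-1)$. The Frattini subgroup $\Phi(G)$ of a finite group $G$ is the intersection of all maximal subgroups of $G$. For a nontrivial finite group $G$, the intersection number $\iota(G)$ is the minimum number of maximal subgroups of $G$ whose intersection equals $\Phi(G)$. Two subgroups $H,K$ of $G$ are conjugate if $gHg^{-1}=K$ for some $g\in G$, and inconjugate otherwise. The inconjugate intersection number $\hat\iota(G)$ is the minimum number of (pairwise) inconjugate maximal subgroups of $G$ whose intersection equals $\Phi(G)$; if no collection of pairwise inconjugate maximal subgroups of $G$ has intersection $\Phi(G)$, then $\hat\iota(G)=\infty$. *)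

theory Defs
  imports
    "HOL-Algebra.Coset"
    "HOL-Number_Theory.Number_Theory"
    "HOL-Computational_Algebra.Squarefree"
    "HOL-Library.Extended_Nat"
begin

section \<open>Groups given by generators and relations\<close>

text \<open>
  A letter \<open>(a, True)\<close> stands for the generator \<open>a\<close>, and \<open>(a, False)\<close> for its formal inverse.
  A relation \<open>(u, v)\<close> is read as \<open>u = v\<close>.
\<close>

type_synonym 'a gword = "('a \<times> bool) list"

inductive word_eq :: "('a gword \<times> 'a gword) set \<Rightarrow> 'a gword \<Rightarrow> 'a gword \<Rightarrow> bool"
  for R :: "('a gword \<times> 'a gword) set"
where
  refl: "word_eq R u u"
| sym: "word_eq R u v \<Longrightarrow> word_eq R v u"
| trans: "word_eq R u v \<Longrightarrow> word_eq R v w \<Longrightarrow> word_eq R u w"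
| append: "word_eq R u v \<Longrightarrow> word_eq R (s @ u @ t) (s @ v @ t)"
| cancel: "word_eq R [(a, b), (a, \<not> b)] []"
| relation: "(u, v) \<in> R \<Longrightarrow> word_eq R u v"

definition word_rel :: "('a gword \<times> 'a gword) set \<Rightarrow> ('a gword \<times> 'a gword) set" where
  "word_rel R = {(u, v). word_eq R u v}"

definition presented_group :: "('a gword \<times> 'a gword) set \<Rightarrow> 'a gword set monoid" where
  "presented_group R =
     \<lparr>carrier = UNIV // word_rel R,
      mult = (\<lambda>A B. \<Union>u\<in>A. \<Union>v\<in>B. word_rel R `` {u @ v}),
      one = word_rel R `` {[]}\<rparr>"

lemma equiv_word_rel: "equiv UNIV (word_rel R)"
proof (rule equivI)
  show "word_rel R \<subseteq> UNIV \<times> UNIV" by simp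
  show "refl (word_rel R)"
    by (rule refl_onI) (simp add: word_rel_def word_eq.refl)
  show "sym (word_rel R)"
    by (rule symI) (simp add: word_rel_def word_eq.sym)
  show "trans (word_rel R)"
    by (rule transI) (unfold word_rel_def mem_Collect_eq case_prod_conv, rule word_eq.trans)
qed

lemma word_eq_append:
  assumes "word_eq R u u'" "word_eq R v v'"
  shows "word_eq R (u @ v) (u' @ v')"
proof (rule word_eq.trans)
  show "word_eq R (u @ v) (u' @ v)"
    using word_eq.append[OF assms(1), of "[]" v] by simp
  show "word_eq R (u' @ v) (u' @ v')"
    using word_eq.append[OF assms(2), of u' "[]"] by simp
qed

lemma mult_presented_group:
  "word_rel R `` {u} \<otimes>\<^bsub>presented_group R\<^esub> word_rel R `` {v} = word_rel R `` {u @ v}"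
proof -
  have "word_rel R `` {u' @ v'} = word_rel R `` {u @ v}"
    if "u' \<in> word_rel R `` {u}" "v' \<in> word_rel R `` {v}" for u' v'
  proof -
    have "(u @ v, u' @ v') \<in> word_rel R"
      using that word_eq_append[of R u u' v v'] by (simp add: word_rel_def)
    then show ?thesis using equiv_class_eq[OF equiv_word_rel] by blast
  qed
  moreover have "u \<in> word_rel R `` {u}" "v \<in> word_rel R `` {v}"
    by (simp_all add: word_rel_def word_eq.refl)
  ultimately have "(\<Union>u'\<in>word_rel R `` {u}. \<Union>v'\<in>word_rel R `` {v}. word_rel R `` {u' @ v'}) =
      word_rel R `` {u @ v}"
    by blast
  then show ?thesis by (simp add: presented_group_def)
qed

lemma word_eq_left_inverse:
  "word_eq R (rev (map (\<lambda>(a, b). (a, \<not> b)) u) @ u) []"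
proof (induction u)
  case Nil
  show ?case by (simp add: word_eq.refl)
next
  case (Cons l u)
  obtain a b where l: "l = (a, b)" by (cases l)
  let ?s = "rev (map (\<lambda>(a, b). (a, \<not> b)) u)"
  have "word_eq R (?s @ [(a, \<not> b), (a, \<not> \<not> b)] @ u) (?s @ [] @ u)"
    by (rule word_eq.append[OF word_eq.cancel])
  then have "word_eq R (?s @ [(a, \<not> b), (a, \<not> \<not> b)] @ u) []"
    by (rule word_eq.trans) (use Cons in simp)
  then show ?case by (simp add: l)
qed

lemma group_presented_group: "group (presented_group R)"
proof (rule groupI)
  have cls: "\<exists>u. x = word_rel R `` {u}" if "x \<in> carrier (presented_group R)" for x
    using that by (auto simp: presented_group_def elim: quotientE)
  have car: "word_rel R `` {u} \<in> carrier (presented_group R)" for u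
    by (auto simp: presented_group_def intro: quotientI)
  have one: "\<one>\<^bsub>presented_group R\<^esub> = word_rel R `` {[]}"
    by (simp add: presented_group_def)
  show "x \<otimes>\<^bsub>presented_group R\<^esub> y \<in> carrier (presented_group R)"
    if "x \<in> carrier (presented_group R)" "y \<in> carrier (presented_group R)" for x y
    using cls[OF that(1)] cls[OF that(2)] by (auto simp: mult_presented_group car)
  show "\<one>\<^bsub>presented_group R\<^esub> \<in> carrier (presented_group R)"
    by (simp add: one car)
  show "x \<otimes>\<^bsub>presented_group R\<^esub> y \<otimes>\<^bsub>presented_group R\<^esub> z =
        x \<otimes>\<^bsub>presented_group R\<^esub> (y \<otimes>\<^bsub>presented_group R\<^esub> z)"
    if "x \<in> carrier (presented_group R)" "y \<in> carrier (presented_group R)"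
       "z \<in> carrier (presented_group R)" for x y z
    using cls[OF that(1)] cls[OF that(2)] cls[OF that(3)] by (auto simp: mult_presented_group)
  show "\<one>\<^bsub>presented_group R\<^esub> \<otimes>\<^bsub>presented_group R\<^esub> x = x"
    if "x \<in> carrier (presented_group R)" for x
    using cls[OF that] by (auto simp: one mult_presented_group)
  show "\<exists>y\<in>carrier (presented_group R). y \<otimes>\<^bsub>presented_group R\<^esub> x = \<one>\<^bsub>presented_group R\<^esub>"
    if "x \<in> carrier (presented_group R)" for x
  proof -
    from cls[OF that] obtain u where u: "x = word_rel R `` {u}" by blast
    let ?v = "rev (map (\<lambda>(a, b). (a, \<not> b)) u)"
    have "word_rel R `` {?v @ u} = word_rel R `` {[]}"
      by (rule equiv_class_eq[OF equiv_word_rel]) (simp add: word_rel_def word_eq_left_inverse)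
    then show ?thesis using car u one mult_presented_group by metis
  qed
qed

section \<open>The Frobenius group of order \<open>p (p - 1)\<close>\<close>

datatype frobenius_gen = Gen_x | Gen_y

text \<open>
  The unit \<open>r\<close> of the integers modulo \<open>p\<close> is given by any natural number representing it; the
  choice does not matter because of the relation \<open>x ^ p = 1\<close>.  The relations are
  \<open>x ^ p = 1\<close>, \<open>y ^ (p - 1) = 1\<close> and \<open>y\<inverse> x y = x ^ r\<close>.
\<close>

definition frobenius_group :: "nat \<Rightarrow> nat \<Rightarrow> frobenius_gen gword set monoid" where
  "frobenius_group p r = presented_group
     {(replicate p (Gen_x, True), []),
      (replicate (p - 1) (Gen_y, True), []),
      ([(Gen_y, False), (Gen_x, True), (Gen_y, True)], replicate r (Gen_x, True))}"

section \<open>Maximal subgroups and intersection numbers\<close>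

definition maximal_subgroup :: "'a set \<Rightarrow> ('a, 'b) monoid_scheme \<Rightarrow> bool" where
  "maximal_subgroup M G \<longleftrightarrow>
     subgroup M G \<and> M \<noteq> carrier G \<and>
     (\<forall>H. subgroup H G \<and> M \<subseteq> H \<longrightarrow> H = M \<or> H = carrier G)"

text \<open>
  Intersecting with the carrier makes the intersection of the empty family the whole group.
\<close>

definition subgroup_Inter :: "('a, 'b) monoid_scheme \<Rightarrow> 'a set set \<Rightarrow> 'a set" where
  "subgroup_Inter G S = carrier G \<inter> \<Inter>S"

definition frattini :: "('a, 'b) monoid_scheme \<Rightarrow> 'a set" where
  "frattini G = subgroup_Inter G {M. maximal_subgroup M G}"

definition conjugate_subgroups :: "('a, 'b) monoid_scheme \<Rightarrow> 'a set \<Rightarrow> 'a set \<Rightarrow> bool" where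
  "conjugate_subgroups G H K \<longleftrightarrow>
     (\<exists>g\<in>carrier G. g <#\<^bsub>G\<^esub> H #>\<^bsub>G\<^esub> inv\<^bsub>G\<^esub> g = K)"

text \<open>
  Both numbers are meant for nontrivial finite groups.  They are infima in \<^typ>\<open>enat\<close>, so that
  the value is \<open>\<infinity>\<close> when there is no suitable family, and is attained otherwise.
\<close>

definition intersection_number :: "('a, 'b) monoid_scheme \<Rightarrow> enat" where
  "intersection_number G =
     Inf {enat (card S) | S. finite S \<and> (\<forall>M\<in>S. maximal_subgroup M G) \<and>
            subgroup_Inter G S = frattini G}"

definition inconjugate_intersection_number :: "('a, 'b) monoid_scheme \<Rightarrow> enat" where
  "inconjugate_intersection_number G =
     Inf {enat (card S) | S. finite S \<and> (\<forall>M\<in>S. maximal_subgroup M G) \<and>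
            pairwise (\<lambda>H K. \<not> conjugate_subgroups G H K) S \<and>
            subgroup_Inter G S = frattini G}"

end

theory Submission
  imports Defs
begin

text \<open>
  The group acts on the integers modulo \<open>p\<close> from the right, \<open>x\<close> by \<open>t \<mapsto> t + 1\<close> and \<open>y\<close> by
  \<open>t \<mapsto> r t\<close>; this shows that the elements \<open>y\<^sup>j x\<^sup>i\<close> with \<open>j\<close> modulo \<open>p - 1\<close> and \<open>i\<close> modulo \<open>p\<close>
  are distinct.  A nontrivial element outside \<open>\<langle>x\<rangle>\<close> has exactly one fixed point.  A nontrivial
  subgroup that meets \<open>\<langle>x\<rangle>\<close> trivially is abelian, so it fixes the fixed point of each of its
  nontrivial elements.  Hence the maximal subgroups are the \<open>p\<close> point stabilizers, which are all
  conjugate, and the normal subgroups \<open>\<langle>x, y\<^sup>q\<rangle>\<close> for the primes \<open>q\<close> dividing \<open>p - 1\<close>.  Two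
  stabilizers intersect trivially.  A pairwise inconjugate family contains at most one
  stabilizer, and it needs one, because all other maximal subgroups contain \<open>x\<close>; together with
  \<open>\<langle>x, y\<^sup>q\<rangle>\<close> for \<open>q \<in> Q\<close> it intersects in the powers of a conjugate of \<open>y\<close> with exponent divisible
  by \<open>\<Prod>Q\<close>, so the intersection is trivial only if \<open>p - 1\<close> divides \<open>\<Prod>Q\<close>.
\<close>

text \<open>Prime by prime: a prime factor of the square-free \<open>n\<close> has multiplicity at
  most 1 in \<open>n\<close> and at least 1 in a nonzero \<open>m\<close>.\<close>

lemma squarefree_dvdI:
  fixes m n :: nat
  assumes "squarefree n" "\<And>q. q \<in> prime_factors n \<Longrightarrow> q dvd m" shows "n dvd m"
proof (cases "m = 0")
  case False
  have n: "n \<noteq> 0" using assms(1) by (cases "n = 0") auto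
  have "multiplicity q n \<le> multiplicity q m" if q: "prime q" for q
  proof (cases "q dvd n")
    case True
    then have "q dvd m" using assms(2) q n by (simp add: in_prime_factors_iff)
    then have "multiplicity q m \<ge> 1"
      using False q by (simp add: prime_multiplicity_gt_zero_iff Suc_le_eq)
    moreover have "multiplicity q n \<le> 1"
      using assms(1) n q squarefree_factorial_semiring'' by blast
    ultimately show ?thesis by linarith
  qed (simp add: not_dvd_imp_multiplicity_0)
  then show ?thesis using n False prime_multiplicity_le_imp_dvd by blast
qed simp

text \<open>Coordinates are natural numbers, so \<open>(m - 1) * k\<close> stands for the negative
  of \<open>k\<close> modulo \<open>m\<close>; this is the corresponding cancellation.\<close>

lemma add_mult_pred: "k + (m - 1) * k = m * k" if "m > 0" for k m :: nat
  using that by (cases m) auto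

section \<open>Groups with the coordinates of an affine group\<close>

text \<open>The element \<open>e j i\<close> stands for \<open>y\<^sup>j x\<^sup>i\<close>, that is, for the affine map \<open>t \<mapsto> r\<^sup>j t + i\<close>.\<close>

locale affine_coordinates = group G for G (structure) +
  fixes p r :: nat and e :: "nat \<Rightarrow> nat \<Rightarrow> 'a"
  assumes prime_p: "prime p" and p_ge: "p \<ge> 3"
    and power_r_cong_1: "[r ^ j = 1] (mod p) \<longleftrightarrow> p - 1 dvd j"
    and e_mult: "e j i \<otimes> e j' i' = e (j + j') (r ^ j' * i + i')"
    and e_eq_iff: "e j i = e j' i' \<longleftrightarrow> [j = j'] (mod (p - 1)) \<and> [i = i'] (mod p)"
    and carrier_eq: "carrier G = {e j i | j i. True}"
begin

lemma e_closed [simp, intro]: "e j i \<in> carrier G"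
  by (auto simp: carrier_eq)

lemma carrierE:
  assumes "g \<in> carrier G" obtains j i where "g = e j i"
  using assms by (auto simp: carrier_eq)

lemma one_eq: "\<one> = e 0 0"
proof -
  have "e 0 0 \<otimes> e 0 0 = e 0 0" by (simp add: e_mult)
  then show ?thesis by (metis e_closed l_cancel_one)
qed

lemma e_eq_one_iff: "e j i = \<one> \<longleftrightarrow> p - 1 dvd j \<and> p dvd i"
  by (simp add: one_eq e_eq_iff cong_0_iff)

lemma add_mult_pred2: "j + (p - 2) * j = (p - 1) * j"
  using add_mult_pred[of "p - 1" j] p_ge by (simp add: numeral_eq_Suc)

lemma power_r_mult_pred: "[r ^ (j + (p - 2) * j) = 1] (mod p)"
  by (simp only: add_mult_pred2 power_r_cong_1 dvd_triv_left)

text \<open>This is x^-i y^-j brought into the order y, x. Exponents of y count modulo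
  \<open>p - 1\<close> and those of x modulo \<open>p\<close>, so the negatives are
  \<open>(p - 2) * j\<close> and \<open>(p - 1) * i\<close>.\<close>

lemma inv_e: "inv (e j i) = e ((p - 2) * j) (r ^ ((p - 2) * j) * ((p - 1) * i))"
proof (rule inv_equality)
  let ?j = "(p - 2) * j"
  have 1: "?j + j = (p - 1) * j" using add_mult_pred2[of j] by simp
  have "[r ^ j * (r ^ ?j * ((p - 1) * i)) + i = 1 * ((p - 1) * i) + i] (mod p)"
    using cong_mult[OF power_r_mult_pred[of j] cong_refl[of "(p - 1) * i"]]
    by (intro cong_add cong_refl) (simp add: power_add mult.assoc)
  also have "1 * ((p - 1) * i) + i = p * i"
    using add_mult_pred[of p i] p_ge by simp
  finally have "p dvd r ^ j * (r ^ ?j * ((p - 1) * i)) + i"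
    using cong_dvd_iff by fastforce
  then show "e ?j (r ^ ?j * ((p - 1) * i)) \<otimes> e j i = \<one>"
    using 1 by (simp add: e_mult e_eq_one_iff)
qed auto

lemma inv_e_0: "inv (e 0 i) = e 0 ((p - 1) * i)"
  by (simp add: inv_e)

lemma e_0_mult_mem:
  assumes "subgroup K G" "e 0 i \<in> K" shows "e 0 (m * i) \<in> K"
proof (induction m)
  case 0 then show ?case using subgroup.one_closed[OF assms(1)] by (simp add: one_eq)
next
  case (Suc m)
  then show ?case using subgroup.m_closed[OF assms(1) assms(2) Suc] by (simp add: e_mult)
qed

lemma e_mult_0_mem:
  assumes "subgroup K G" "e j 0 \<in> K" shows "e (m * j) 0 \<in> K"
proof (induction m)
  case 0 then show ?case using subgroup.one_closed[OF assms(1)] by (simp add: one_eq)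
next
  case (Suc m)
  then show ?case using subgroup.m_closed[OF assms(1) assms(2) Suc] by (simp add: e_mult)
qed

text \<open>The residue of \<open>i\<close> is invertible modulo the prime \<open>p\<close>, so some
  power of x^i is x^k.\<close>

lemma translations_mem:
  assumes "subgroup K G" "e 0 i \<in> K" "\<not> p dvd i" shows "e 0 k \<in> K"
proof -
  have "coprime i p" using prime_imp_coprime[OF prime_p assms(3)] by (simp add: coprime_commute)
  from cong_solve_coprime_nat[OF this] obtain m where "[i * m = 1] (mod p)" by auto
  then have "[k * m * i = k * 1] (mod p)"
    using cong_scalar_left[of "i * m" 1 p k] by (simp add: mult_ac)
  then have "e 0 (k * m * i) = e 0 k" by (simp add: e_eq_iff)
  then show ?thesis using e_0_mult_mem[OF assms(1,2)] by metis
qed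

lemma e_split: "e j i = e j 0 \<otimes> e 0 i"
  by (simp add: e_mult)

text \<open>In (y^j x^a)^-1 y^j x^b the powers of y cancel and x^(b - a) remains.\<close>

lemma diff_mem:
  assumes "subgroup K G" "e j a \<in> K" "e j b \<in> K" shows "e 0 ((p - 1) * a + b) \<in> K"
proof -
  have "inv (e j a) \<otimes> e j b \<in> K"
    using assms by (simp add: subgroup.m_closed subgroup.m_inv_closed)
  moreover have "inv (e j a) \<otimes> e j b = inv (e 0 a) \<otimes> (inv (e j 0) \<otimes> e j 0) \<otimes> e 0 b"
    unfolding e_split[of j a] e_split[of j b] by
      (simp only: inv_mult_group m_assoc m_closed inv_closed e_closed)
  moreover have "\<dots> = e 0 ((p - 1) * a + b)"
    by (simp only: l_inv e_closed) (simp add: inv_e_0 e_mult)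
  ultimately show ?thesis by metis
qed

section \<open>Point stabilizers and the subgroups of divisible exponents\<close>

definition stabilizer :: "nat \<Rightarrow> 'a set" where
  "stabilizer t = {e j i | j i. [r ^ j * t + i = t] (mod p)}"

text \<open>For \<open>q\<close> dividing \<open>p - 1\<close> this is the normal subgroup generated
  by x and y^q, of index \<open>q\<close>.\<close>

definition divisible_part :: "nat \<Rightarrow> 'a set" where
  "divisible_part q = {e j i | j i. q dvd j}"

lemma power_r_cong:
  assumes "[j = j'] (mod (p - 1))" shows "[r ^ j = r ^ j'] (mod p)"
proof -
  have *: "[r ^ j = r ^ j'] (mod p)" if "[j = j'] (mod (p - 1))" "j \<le> j'" for j j'
  proof -
    have "p - 1 dvd j' - j" using that by (metis cong_altdef_nat cong_sym)
    then have "[r ^ j * r ^ (j' - j) = r ^ j * 1] (mod p)"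
      by (intro cong_mult cong_refl) (simp only: power_r_cong_1)
    then show ?thesis using that(2) by (simp add: cong_sym flip: power_add)
  qed
  show ?thesis using *[of j j'] *[of j' j] assms by (meson cong_sym nat_le_linear)
qed

text \<open>The condition is independent of the chosen coordinates, because \<open>r ^ j\<close>
  modulo \<open>p\<close> depends only on \<open>j\<close> modulo \<open>p - 1\<close>.\<close>

lemma e_mem_stabilizer: "e j i \<in> stabilizer t \<longleftrightarrow> [r ^ j * t + i = t] (mod p)"
proof
  assume "e j i \<in> stabilizer t"
  then obtain j' i' where 1: "e j i = e j' i'" "[r ^ j' * t + i' = t] (mod p)"
    by (auto simp: stabilizer_def)
  then have "[r ^ j * t + i = r ^ j' * t + i'] (mod p)"
    by (auto simp: e_eq_iff intro!: cong_add cong_mult power_r_cong)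
  then show "[r ^ j * t + i = t] (mod p)" using 1 cong_trans by blast
qed (auto simp: stabilizer_def)

lemma e_mem_divisible_part:
  assumes "q dvd p - 1" shows "e j i \<in> divisible_part q \<longleftrightarrow> q dvd j"
proof
  assume "e j i \<in> divisible_part q"
  then obtain j' i' where "e j i = e j' i'" "q dvd j'" by (auto simp: divisible_part_def)
  then show "q dvd j" using assms by (meson e_eq_iff cong_dvd_iff cong_dvd_modulus_nat)
qed (auto simp: divisible_part_def)

text \<open>Composition of affine maps acting from the right: \<open>s\<close> goes to
  \<open>t\<close>, then \<open>t\<close> goes to \<open>u\<close>. The coordinates are those of the
  product in \<open>e_mult\<close>.\<close>

lemma fixed_point_mult:
  assumes "[r ^ j * s + i = t] (mod p)" "[r ^ j' * t + i' = u] (mod p)"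
  shows "[r ^ (j + j') * s + (r ^ j' * i + i') = u] (mod p)"
proof -
  have "[r ^ j' * (r ^ j * s + i) + i' = r ^ j' * t + i'] (mod p)"
    using assms(1) by (intro cong_add cong_mult cong_refl)
  then show ?thesis
    using assms(2) by (auto simp: power_add algebra_simps intro: cong_trans)
qed

lemma subgroup_stabilizer: "subgroup (stabilizer t) G"
proof (rule subgroupI)
  show "stabilizer t \<subseteq> carrier G" by (auto simp: stabilizer_def)
  have "e 0 0 \<in> stabilizer t" by (simp add: e_mem_stabilizer)
  then show "stabilizer t \<noteq> {}" by blast
next
  fix a b assume "a \<in> stabilizer t" "b \<in> stabilizer t"
  then obtain j i j' i' where "a = e j i" "b = e j' i'"
    "[r ^ j * t + i = t] (mod p)" "[r ^ j' * t + i' = t] (mod p)"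
    by (auto simp: stabilizer_def)
  then show "a \<otimes> b \<in> stabilizer t"
    by (simp only: e_mult e_mem_stabilizer fixed_point_mult)
next
  fix a assume "a \<in> stabilizer t"
  then obtain j i where a: "a = e j i" and 1: "[r ^ j * t + i = t] (mod p)"
    by (auto simp: stabilizer_def)
  \<comment> \<open>Any coordinates of the inverse will do: that its product with \<open>a\<close>
    acts as the identity is enough, since \<open>a\<close> fixes \<open>t\<close>.\<close>
  obtain j' i' where b: "inv a = e j' i'" by (metis a carrierE e_closed inv_closed)
  have "e j i \<otimes> e j' i' = e 0 0" using a b one_eq by (metis e_closed r_inv)
  then have 2: "[j + j' = 0] (mod (p - 1))" "[r ^ j' * i + i' = 0] (mod p)"
    by (auto simp: e_mult e_eq_iff)
  have "[r ^ j' * t + i' = r ^ (j + j') * t + (r ^ j' * i + i')] (mod p)"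
    using fixed_point_mult[OF 1 cong_refl] cong_sym by blast
  also have "[r ^ (j + j') * t + (r ^ j' * i + i') = r ^ 0 * t + 0] (mod p)"
    using 2 by (intro cong_add cong_mult cong_refl power_r_cong)
  finally show "inv a \<in> stabilizer t" by (simp add: b e_mem_stabilizer)
qed

lemma subgroup_divisible_part: "subgroup (divisible_part q) G"
proof (rule subgroupI)
  show "divisible_part q \<subseteq> carrier G" by (auto simp: divisible_part_def)
  show "divisible_part q \<noteq> {}" by (auto simp: divisible_part_def)
next
  fix a b assume "a \<in> divisible_part q" "b \<in> divisible_part q"
  then show "a \<otimes> b \<in> divisible_part q"
    unfolding divisible_part_def using dvd_add by (fastforce simp: e_mult)
next
  fix a assume "a \<in> divisible_part q"
  then show "inv a \<in> divisible_part q"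
    unfolding divisible_part_def by (auto simp: inv_e) (metis dvd_mult)
qed

lemma stabilizer_cong:
  assumes "[s = t] (mod p)" shows "stabilizer s = stabilizer t"
proof -
  have *: "stabilizer s \<subseteq> stabilizer t" if st: "[s = t] (mod p)" for s t
  proof
    fix g assume "g \<in> stabilizer s"
    then obtain j i where g: "g = e j i" "[r ^ j * s + i = s] (mod p)"
      by (auto simp: stabilizer_def)
    have "[r ^ j * t + i = r ^ j * s + i] (mod p)"
      using st by (intro cong_add cong_mult cong_refl) (rule cong_sym)
    then have "[r ^ j * t + i = t] (mod p)"
      using g(2) st cong_trans by blast
    then show "g \<in> stabilizer t" by (simp add: g e_mem_stabilizer)
  qed
  show ?thesis using *[OF assms] *[OF cong_sym[OF assms]] by (rule subset_antisym)
qed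

text \<open>Subtracting the two fixed point equations, over the integers, gives (r^j - 1)(s - t) = 0
  modulo \<open>p\<close>. Hence r^j = 1, and a translation with a fixed point is trivial.\<close>

lemma stabilizer_Int:
  assumes "\<not> [s = t] (mod p)" shows "stabilizer s \<inter> stabilizer t \<subseteq> {\<one>}"
proof
  fix g assume "g \<in> stabilizer s \<inter> stabilizer t"
  then obtain j i where g: "g = e j i" and "e j i \<in> stabilizer s" "e j i \<in> stabilizer t"
    by (auto simp: stabilizer_def)
  then have 1: "[r ^ j * s + i = s] (mod p)" "[r ^ j * t + i = t] (mod p)"
    by (auto simp: e_mem_stabilizer)
  then have "[int (r ^ j * s + i) - int (r ^ j * t + i) = int s - int t] (mod int p)"
    by (intro cong_diff) (simp_all only: cong_int_iff)
  then have "int p dvd (int (r ^ j) - 1) * (int s - int t)"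
    by (simp add: cong_iff_dvd_diff algebra_simps)
  moreover have "\<not> int p dvd int s - int t"
    using assms by (simp add: cong_iff_dvd_diff flip: cong_int_iff)
  ultimately have "int p dvd int (r ^ j) - int 1"
    using prime_p by (simp add: prime_dvd_mult_iff)
  then have 2: "[r ^ j = 1] (mod p)"
    by (simp only: cong_iff_dvd_diff flip: cong_int_iff)
  then have "[r ^ j * s + i = 1 * s + i] (mod p)" by (intro cong_add cong_mult cong_refl)
  then have "[s + i = s] (mod p)" using 1 by (metis cong_sym cong_trans mult_1)
  then have "p dvd i" using cong_add_lcancel_0_nat cong_0_iff by blast
  then show "g \<in> {\<one>}" using 2 power_r_cong_1[of j] by (simp add: g e_eq_one_iff)
qed

section \<open>Classification of the maximal subgroups\<close>

lemma subgroup_cases: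
  assumes K: "subgroup K G"
  obtains "\<And>i. e 0 i \<in> K" | t where "K \<subseteq> stabilizer t"
proof (cases "\<forall>i. e 0 i \<in> K \<longrightarrow> p dvd i")
  case False
  then show ?thesis using translations_mem[OF K] that by blast
next
  case triv: True
  show ?thesis
  proof (cases "K \<subseteq> {\<one>}")
    case True
    then have "K \<subseteq> stabilizer 0" using subgroup.one_closed[OF subgroup_stabilizer] by blast
    then show ?thesis by (rule that)
  next
    case False
    then obtain g where "g \<in> K" "g \<noteq> \<one>" by blast
    moreover obtain j i where "g = e j i"
      using carrierE subgroup.mem_carrier[OF K \<open>g \<in> K\<close>] by blast
    ultimately have g: "e j i \<in> K" "e j i \<noteq> \<one>" by auto
    have "\<not> p - 1 dvd j"
    proof
      assume "p - 1 dvd j"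
      then have "e j i = e 0 i" by (simp add: e_eq_iff cong_0_iff)
      then show False using g triv \<open>p - 1 dvd j\<close> by (metis e_eq_one_iff)
    qed
    then have "\<not> [int (r ^ j) = int 1] (mod int p)"
      by (simp only: cong_int_iff power_r_cong_1 not_False_eq_True)
    then have nd: "\<not> int p dvd 1 - int (r ^ j)"
      by (simp add: cong_iff_dvd_diff dvd_diff_commute)
    then have "coprime (1 - int (r ^ j)) (int p)"
      using prime_imp_coprime[OF _ nd] prime_p by (simp add: coprime_commute)
    from cong_solve_coprime_int[OF this] obtain m where "[(1 - int (r ^ j)) * m = 1] (mod int p)"
      by blast
    from cong_scalar_right[OF this, of "int i"]
    have m: "[(1 - int (r ^ j)) * (m * int i) = int i] (mod int p)"
      by (simp add: mult.assoc)
    \<comment> \<open>The fixed point of \<open>e j i\<close> solves (1 - r^j) t = i modulo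
      \<open>p\<close>, and \<open>m\<close> is the inverse of 1 - r^j.\<close>
    define t where "t = nat (m * int i mod int p)"
    have "[int t = m * int i] (mod int p)"
      using p_ge by (simp add: t_def cong_def)
    then have "[(1 - int (r ^ j)) * int t = (1 - int (r ^ j)) * (m * int i)] (mod int p)"
      by (rule cong_scalar_left)
    then have t: "[(1 - int (r ^ j)) * int t = int i] (mod int p)"
      using m by (rule cong_trans)
    have "K \<subseteq> stabilizer t"
    proof
      fix h assume h: "h \<in> K"
      then obtain j' i' where h': "h = e j' i'"
        using carrierE subgroup.mem_carrier[OF K h] by blast
      \<comment> \<open>The products of \<open>e j i\<close> and \<open>h\<close> in the two orders
        have the same exponent of y, so they differ by a translation in \<open>K\<close>, which is
        trivial by \<open>triv\<close>.\<close>
      have "e (j + j') (r ^ j' * i + i') \<in> K" "e (j + j') (r ^ j * i' + i) \<in> K"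
        using subgroup.m_closed[OF K g(1) h] subgroup.m_closed[OF K h g(1)]
        by (simp_all add: h' e_mult add.commute)
      from diff_mem[OF K this] have "p dvd (p - 1) * (r ^ j' * i + i') + (r ^ j * i' + i)"
        using triv by blast
      then have "int p dvd int ((p - 1) * (r ^ j' * i + i') + (r ^ j * i' + i))"
        by (simp only: int_dvd_int_iff)
      moreover have "int (p - 1) = int p - 1" using p_ge by (simp add: of_nat_diff)
      ultimately have "int p dvd (int p - 1) * int (r ^ j' * i + i') + int (r ^ j * i' + i)"
        by (simp only: of_nat_add of_nat_mult)
      then obtain c where c: "(int p - 1) * int (r ^ j' * i + i') + int (r ^ j * i' + i) = int p * c"
        by blast
      from t obtain d where d: "(1 - int (r ^ j)) * int t - int i = int p * d"
        by (auto simp: cong_iff_dvd_diff)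
      \<comment> \<open>The displacement of \<open>t\<close> under \<open>h\<close>, times 1 - r^j,
        is a combination of the fixed point equation \<open>d\<close>, the commutation equation
        \<open>c\<close> and a multiple of \<open>p\<close>.\<close>
      have "(1 - int (r ^ j)) * (int (r ^ j') * int t + int i' - int t) =
          (int (r ^ j') - 1) * ((1 - int (r ^ j)) * int t - int i) + int p * int (r ^ j' * i + i') -
          ((int p - 1) * int (r ^ j' * i + i') + int (r ^ j * i' + i))"
        by (simp add: algebra_simps)
      also have "\<dots> = int p * ((int (r ^ j') - 1) * d + int (r ^ j' * i + i') - c)"
        unfolding c d by (simp add: algebra_simps)
      finally have "(1 - int (r ^ j)) * (int (r ^ j') * int t + int i' - int t) = \<dots>" .
      then have "int p dvd (1 - int (r ^ j)) * (int (r ^ j') * int t + int i' - int t)"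
        by simp
      then have "int p dvd int (r ^ j') * int t + int i' - int t"
        using nd prime_p by (simp add: prime_dvd_mult_iff)
      then have "[int (r ^ j' * t + i') = int t] (mod int p)"
        by (simp add: cong_iff_dvd_diff)
      then show "h \<in> stabilizer t" by (simp only: cong_int_iff h' e_mem_stabilizer)
    qed
    then show ?thesis by (rule that)
  qed
qed

lemma carrier_eqI:
  assumes "subgroup K G" "\<And>i. e 0 i \<in> K" "e 1 0 \<in> K" shows "K = carrier G"
proof
  have "e j 0 \<otimes> e 0 i \<in> K" for j i
    using e_mult_0_mem[OF assms(1,3), of j] assms(1,2) by (simp add: subgroup.m_closed)
  then show "carrier G \<subseteq> K" by (auto simp: carrier_eq simp flip: e_split)
qed (rule subgroup.subset[OF assms(1)])

lemma remove_translation: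
  assumes "subgroup K G" "\<And>i. e 0 i \<in> K" "e j i \<in> K" shows "e j 0 \<in> K"
proof -
  have "e j i \<otimes> e 0 ((p - 1) * i) \<in> K" using assms by (simp add: subgroup.m_closed)
  also have "e j i \<otimes> e 0 ((p - 1) * i) = e j (p * i)"
    using add_mult_pred[of p i] p_ge by (simp add: e_mult)
  also have "\<dots> = e j 0" by (simp add: e_eq_iff cong_0_iff)
  finally show ?thesis .
qed

text \<open>The second coordinate is t - r^j t modulo \<open>p\<close>, so every exponent of y
  occurs in each stabilizer.\<close>

lemma e_mem_stabilizer_exists: "e j (t + (p - 1) * (r ^ j * t)) \<in> stabilizer t"
proof -
  have "r ^ j * t + (t + (p - 1) * (r ^ j * t)) = t + p * (r ^ j * t)"
    using add_mult_pred[of p "r ^ j * t"] p_ge by simp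
  then show ?thesis by (simp only: e_mem_stabilizer) (simp add: cong_def)
qed

lemma stabilizer_nontrivial: "\<not> stabilizer t \<subseteq> {\<one>}"
proof -
  have "\<not> p - 1 dvd 1" using p_ge by auto
  then show ?thesis using e_mem_stabilizer_exists[of 1 t] e_eq_one_iff by blast
qed

lemma translation_not_mem_stabilizer: "e 0 1 \<notin> stabilizer t"
proof
  assume "e 0 1 \<in> stabilizer t"
  then have "[t + 1 = t] (mod p)" by (simp add: e_mem_stabilizer)
  then have "p dvd 1" using cong_add_lcancel_0_nat cong_0_iff by blast
  then show False using p_ge by simp
qed

lemma stabilizer_subset_imp_eq:
  assumes "stabilizer s \<subseteq> stabilizer t" shows "stabilizer s = stabilizer t"
  using stabilizer_cong stabilizer_Int stabilizer_nontrivial assms by blast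

text \<open>A subgroup above it either contains all translations, and then also y, or lies in some
  stabilizer, which must be the same one because distinct stabilizers meet trivially.\<close>

lemma maximal_stabilizer: "maximal_subgroup (stabilizer t) G"
  unfolding maximal_subgroup_def
proof (intro conjI allI impI)
  show "stabilizer t \<noteq> carrier G" using translation_not_mem_stabilizer by blast
next
  fix H assume "subgroup H G \<and> stabilizer t \<subseteq> H"
  then have H: "subgroup H G" "stabilizer t \<subseteq> H" by auto
  from H(1) show "H = stabilizer t \<or> H = carrier G"
  proof (cases rule: subgroup_cases)
    case 1
    then show ?thesis
      using carrier_eqI[OF H(1)] remove_translation[OF H(1), of 1] e_mem_stabilizer_exists[of 1 t] H(2)
      by blast
  next
    case (2 s)
    then show ?thesis using stabilizer_subset_imp_eq[of t s] H(2) by auto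
  qed
qed (rule subgroup_stabilizer)

lemma maximal_divisible_part:
  assumes q: "prime q" "q dvd p - 1" shows "maximal_subgroup (divisible_part q) G"
  unfolding maximal_subgroup_def
proof (intro conjI allI impI)
  have "e 1 0 \<notin> divisible_part q"
    using q(2) prime_gt_1_nat[OF q(1)] by (simp add: e_mem_divisible_part)
  then show "divisible_part q \<noteq> carrier G" by blast
next
  fix H assume "subgroup H G \<and> divisible_part q \<subseteq> H"
  then have H: "subgroup H G" "divisible_part q \<subseteq> H" by auto
  have trans: "e 0 i \<in> H" for i using H(2) by (auto simp: divisible_part_def)
  show "H = divisible_part q \<or> H = carrier G"
  proof (rule disjCI)
    assume "H \<noteq> carrier G"
    have "q dvd j" if "e j i \<in> H" for j i
    proof (rule ccontr)
      assume "\<not> q dvd j"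
      then have "coprime j q" using prime_imp_coprime[OF q(1)] by (simp add: coprime_commute)
      from cong_solve_coprime_nat[OF this] obtain m where m: "[j * m = 1] (mod q)" by auto
      \<comment> \<open>Positivity makes the truncated difference \<open>m * j - 1\<close> a true
        one.\<close>
      have pos: "m * j > 0"
        using m q(1) by (intro Nat.gr0I) (auto simp: mult.commute cong_0_iff cong_sym_eq[of 0])
      then have "q dvd m * j - 1"
        using m cong_altdef_nat[of 1 "m * j" q] by (simp add: mult.commute cong_sym_eq)
      \<comment> \<open>This exponent inverts y^(mj - 1), which lies in
        \<open>divisible_part q\<close>; multiplied by y^(mj) it yields y itself.\<close>
      then have "e ((p - 2) * (m * j - 1)) 0 \<in> H"
        using H(2) q(2) by (auto simp: e_mem_divisible_part)
      moreover have "e (m * j) 0 \<in> H"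
        using e_mult_0_mem[OF H(1)] remove_translation[OF H(1) trans that] by blast
      ultimately have "e (m * j) 0 \<otimes> e ((p - 2) * (m * j - 1)) 0 \<in> H"
        by (intro subgroup.m_closed[OF H(1)])
      then have "e (m * j + (p - 2) * (m * j - 1)) 0 \<in> H" by (simp add: e_mult)
      moreover have "m * j + (p - 2) * (m * j - 1) = 1 + (p - 1) * (m * j - 1)"
        using pos add_mult_pred2[of "m * j - 1"] by linarith
      moreover have "e (1 + (p - 1) * (m * j - 1)) 0 = e 1 0"
        by (simp only: e_eq_iff cong_def mod_mult_self2 simp_thms)
      ultimately have "e 1 0 \<in> H" by simp
      then show False using carrier_eqI[OF H(1) trans] \<open>H \<noteq> carrier G\<close> by blast
    qed
    then have "H \<subseteq> divisible_part q"
      using carrierE subgroup.mem_carrier[OF H(1)] q(2) by (metis e_mem_divisible_part subsetI)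
    then show "H = divisible_part q" using H(2) by blast
  qed
qed (rule subgroup_divisible_part)

lemma maximal_subgroup_cases:
  assumes M: "maximal_subgroup M G"
  obtains t where "M = stabilizer t"
  | q where "prime q" "q dvd p - 1" "M = divisible_part q"
proof -
  have sub: "subgroup M G" and "M \<noteq> carrier G"
    and max: "\<And>H. subgroup H G \<Longrightarrow> M \<subseteq> H \<Longrightarrow> H = M \<or> H = carrier G"
    using M by (auto simp: maximal_subgroup_def)
  from sub show ?thesis
  proof (cases rule: subgroup_cases)
    case (2 t)
    then show ?thesis
      using max[OF subgroup_stabilizer 2] maximal_stabilizer[of t] that(1)
      by (auto simp: maximal_subgroup_def)
  next
    case trans: 1
    \<comment> \<open>A subgroup containing all translations is determined by its exponents of y,
      which are the multiples of the least positive one; any prime factor of \<open>d\<close> then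
      serves as \<open>q\<close>.\<close>
    define d where "d = (LEAST j. j > 0 \<and> e j 0 \<in> M)"
    have "e (p - 1) 0 = \<one>" by (simp add: e_eq_one_iff)
    then have "p - 1 > 0 \<and> e (p - 1) 0 \<in> M" using p_ge subgroup.one_closed[OF sub] by simp
    then have "d > 0 \<and> e d 0 \<in> M" unfolding d_def by (rule LeastI)
    then have d: "d > 0" "e d 0 \<in> M" by auto
    have ddvd: "d dvd j" if "e j 0 \<in> M" for j
    proof -
      have "inv (e (j div d * d) 0) \<otimes> e j 0 \<in> M"
        using e_mult_0_mem[OF sub d(2), of "j div d"] that sub
        by (simp add: subgroup.m_closed subgroup.m_inv_closed)
      also have "e j 0 = e (j div d * d) 0 \<otimes> e (j mod d) 0"
        by (simp add: e_mult)
      also have "inv (e (j div d * d) 0) \<otimes> \<dots> = e (j mod d) 0"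
        by (simp only: m_assoc[symmetric] l_inv l_one inv_closed e_closed)
      finally have "\<not> j mod d > 0"
        using not_less_Least[of "j mod d" "\<lambda>j. j > 0 \<and> e j 0 \<in> M"] d(1) by (auto simp flip: d_def)
      then show ?thesis by auto
    qed
    have "d \<noteq> 1"
      using carrier_eqI[OF sub trans] d(2) \<open>M \<noteq> carrier G\<close> by auto
    then obtain q where q: "prime q" "q dvd d" using prime_factor_nat by blast
    have "d dvd p - 1" using \<open>p - 1 > 0 \<and> e (p - 1) 0 \<in> M\<close> ddvd by blast
    with q(2) have q': "q dvd p - 1" by (rule dvd_trans)
    have "M \<subseteq> divisible_part q"
    proof
      fix g assume g: "g \<in> M"
      then obtain j i where ji: "g = e j i" using carrierE subgroup.mem_carrier[OF sub] by blast
      then have "e j 0 \<in> M" using remove_translation[OF sub trans] g by blast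
      then have "q dvd j" using ddvd q(2) dvd_trans by blast
      then show "g \<in> divisible_part q" using q' by (simp add: ji e_mem_divisible_part)
    qed
    then show ?thesis
      using max[OF subgroup_divisible_part] maximal_divisible_part[OF q(1) q'] that(2)[OF q(1) q']
      by (auto simp: maximal_subgroup_def)
  qed
qed

text \<open>Rules out families with a single member in the lower bound for the intersection
  number.\<close>

lemma maximal_subgroup_nontrivial:
  assumes "maximal_subgroup M G" shows "M \<noteq> {\<one>}"
  using assms
proof (cases rule: maximal_subgroup_cases)
  case (1 t)
  then show ?thesis using stabilizer_nontrivial by blast
next
  case (2 q)
  have "e 0 1 \<in> divisible_part q" by (auto simp: divisible_part_def)
  moreover have "e 0 1 \<noteq> \<one>" using p_ge by (simp add: e_eq_one_iff)
  ultimately show ?thesis using 2 by blast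
qed

section \<open>Conjugacy of the maximal subgroups\<close>

lemma conj_eq_image:
  "g <# H #> h = (\<lambda>a. g \<otimes> a \<otimes> h) ` H"
  by (auto simp: l_coset_def r_coset_def)

text \<open>The three factors move \<open>s\<close> to \<open>t\<close>, keep \<open>t\<close>
  fixed, and return \<open>t\<close> to \<open>s\<close>.\<close>

lemma conj_translation:
  assumes "[s + u = t] (mod p)" "[t + v = s] (mod p)" "h \<in> stabilizer t"
  shows "e 0 u \<otimes> h \<otimes> e 0 v \<in> stabilizer s"
proof -
  obtain j i where h: "h = e j i" "[r ^ j * t + i = t] (mod p)"
    using assms(3) by (auto simp: stabilizer_def)
  have "[r ^ 0 * s + u = t] (mod p)" "[r ^ 0 * t + v = s] (mod p)" using assms by simp_all
  from fixed_point_mult[OF fixed_point_mult[OF this(1) h(2)] this(2)]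
  show ?thesis by (simp only: h(1) e_mult e_mem_stabilizer)
qed

lemma conjugate_stabilizers: "conjugate_subgroups G (stabilizer t) (stabilizer s)"
proof -
  \<comment> \<open>Modulo \<open>p\<close>, \<open>u\<close> represents t - s and \<open>v\<close>
    represents s - t.\<close>
  define u where "u = t + (p - 1) * s"
  define v where "v = (p - 1) * u"
  have su: "[s + u = t] (mod p)"
    using add_mult_pred[of p s] p_ge by (simp add: u_def cong_def add.left_commute[of s])
  have "[t + v = (s + u) + v] (mod p)" using su by (intro cong_add cong_refl) (rule cong_sym)
  also have "(s + u) + v = s + p * u" using add_mult_pred[of p u] p_ge by (simp add: v_def)
  also have "[s + p * u = s] (mod p)" by (simp add: cong_def)
  finally have tv: "[t + v = s] (mod p)" .
  have inv: "inv (e 0 u) = e 0 v" by (simp add: inv_e_0 v_def)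
  have "(\<lambda>a. e 0 u \<otimes> a \<otimes> e 0 v) ` stabilizer t = stabilizer s"
  proof
    show "(\<lambda>a. e 0 u \<otimes> a \<otimes> e 0 v) ` stabilizer t \<subseteq> stabilizer s"
      using conj_translation[OF su tv] by blast
    show "stabilizer s \<subseteq> (\<lambda>a. e 0 u \<otimes> a \<otimes> e 0 v) ` stabilizer t"
    proof
      fix k assume k: "k \<in> stabilizer s"
      then have car: "k \<in> carrier G" using subgroup.mem_carrier[OF subgroup_stabilizer] by blast
      have "k = e 0 u \<otimes> (e 0 v \<otimes> k \<otimes> e 0 u) \<otimes> e 0 v"
      proof -
        have "e 0 u \<otimes> (inv (e 0 u) \<otimes> k \<otimes> e 0 u) \<otimes> inv (e 0 u) =
            (e 0 u \<otimes> inv (e 0 u)) \<otimes> k \<otimes> (e 0 u \<otimes> inv (e 0 u))"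
          using car by (simp only: m_assoc m_closed inv_closed e_closed)
        then show ?thesis
          unfolding inv[symmetric] using car by (simp only: r_inv e_closed l_one r_one)
      qed
      then show "k \<in> (\<lambda>a. e 0 u \<otimes> a \<otimes> e 0 v) ` stabilizer t"
        using conj_translation[OF tv su k] by blast
    qed
  qed
  then show ?thesis
    unfolding conjugate_subgroups_def by (intro bexI[of _ "e 0 u"]) (simp_all only: conj_eq_image inv e_closed)
qed

text \<open>Conjugation preserves the exponent of y modulo \<open>p - 1\<close>, hence modulo
  \<open>q\<close>.\<close>

lemma conj_divisible_part:
  assumes q: "q dvd p - 1" and g: "g \<in> carrier G" and h: "h \<in> carrier G"
  shows "g \<otimes> h \<otimes> inv g \<in> divisible_part q \<longleftrightarrow> h \<in> divisible_part q"
proof -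
  obtain j i a b where ji: "g = e j i" and ab: "h = e a b" using carrierE[OF g] carrierE[OF h] by metis
  have eq: "j + a + (p - 2) * j = a + (p - 1) * j"
    using add_mult_pred2[of j] by simp
  have "q dvd j + a + (p - 2) * j \<longleftrightarrow> q dvd a"
    unfolding eq by (rule dvd_add_left_iff[OF dvd_mult2[OF q]])
  then show ?thesis
    using q by (simp add: ji ab inv_e e_mult e_mem_divisible_part)
qed

lemma maximal_subgroup_subset_eq:
  assumes "maximal_subgroup H G" "maximal_subgroup K G" "H \<subseteq> K" shows "H = K"
  using assms by (auto simp: maximal_subgroup_def)

text \<open>Normality puts \<open>H\<close> inside \<open>divisible_part q\<close>, and maximality
  gives equality. Treating both directions avoids a separate proof that conjugacy is
  symmetric.\<close>

lemma conjugate_divisible_part: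
  assumes q: "prime q" "q dvd p - 1" and H: "maximal_subgroup H G"
    and conj: "conjugate_subgroups G H (divisible_part q) \<or> conjugate_subgroups G (divisible_part q) H"
  shows "H = divisible_part q"
proof -
  note max = maximal_divisible_part[OF q]
  have car: "M \<subseteq> carrier G" if "maximal_subgroup M G" for M
    using that subgroup.subset by (auto simp: maximal_subgroup_def)
  from conj show ?thesis
  proof
    assume "conjugate_subgroups G H (divisible_part q)"
    then obtain g where g: "g \<in> carrier G" "(\<lambda>a. g \<otimes> a \<otimes> inv g) ` H = divisible_part q"
      by (auto simp: conjugate_subgroups_def conj_eq_image)
    have "H \<subseteq> divisible_part q"
    proof
      fix h assume h: "h \<in> H"
      then have "g \<otimes> h \<otimes> inv g \<in> divisible_part q" using g(2) by blast
      then show "h \<in> divisible_part q"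
        using conj_divisible_part[OF q(2) g(1)] car[OF H] h by blast
    qed
    then show ?thesis by (rule maximal_subgroup_subset_eq[OF H max])
  next
    assume "conjugate_subgroups G (divisible_part q) H"
    then obtain g where g: "g \<in> carrier G" "(\<lambda>a. g \<otimes> a \<otimes> inv g) ` divisible_part q = H"
      by (auto simp: conjugate_subgroups_def conj_eq_image)
    then have "H \<subseteq> divisible_part q"
      using conj_divisible_part[OF q(2) g(1)] car[OF max] by blast
    then show ?thesis by (rule maximal_subgroup_subset_eq[OF H max])
  qed
qed

lemma divisible_part_neq_stabilizer: "divisible_part q \<noteq> stabilizer t"
  using translation_not_mem_stabilizer by (auto simp: divisible_part_def)

text \<open>The element y^q tells the subgroups apart; this makes the number of them equal to the
  number of prime factors.\<close>

lemma inj_on_divisible_part: "inj_on divisible_part (prime_factors (p - 1))"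
proof (rule inj_onI)
  fix q q' assume *: "q \<in> prime_factors (p - 1)" "q' \<in> prime_factors (p - 1)"
    and eq: "divisible_part q = divisible_part q'"
  then have dvd: "prime q" "prime q'" "q dvd p - 1" "q' dvd p - 1"
    by (auto dest: in_prime_factors_imp_dvd in_prime_factors_imp_prime)
  have "e q 0 \<in> divisible_part q'" using eq dvd by (auto simp: e_mem_divisible_part simp flip: eq)
  then have "q' dvd q" using dvd by (simp add: e_mem_divisible_part)
  then show "q = q'" using dvd primes_dvd_imp_eq by blast
qed

section \<open>The intersection numbers\<close>

lemma stabilizer_0_Int_1: "stabilizer 0 \<inter> stabilizer 1 = {\<one>}"
proof -
  have "\<not> [0 = 1] (mod p)" using p_ge by (simp add: cong_def)
  then show ?thesis
    using stabilizer_Int[of 0 1] subgroup.one_closed[OF subgroup_stabilizer] by blast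
qed

lemma frattini_eq: "frattini G = {\<one>}"
proof
  show "frattini G \<subseteq> {\<one>}"
    using maximal_stabilizer[of 0] maximal_stabilizer[of 1]
    unfolding stabilizer_0_Int_1[symmetric] frattini_def subgroup_Inter_def by blast
  show "{\<one>} \<subseteq> frattini G"
    by (auto simp: frattini_def subgroup_Inter_def maximal_subgroup_def intro: subgroup.one_closed)
qed

lemma subgroup_Inter_eq_one_iff:
  assumes "\<And>M. M \<in> S \<Longrightarrow> maximal_subgroup M G"
  shows "subgroup_Inter G S = {\<one>} \<longleftrightarrow> (\<forall>j i. (\<forall>M\<in>S. e j i \<in> M) \<longrightarrow> e j i = \<one>)"
proof -
  have "\<one> \<in> subgroup_Inter G S"
    using assms subgroup.one_closed by (auto simp: subgroup_Inter_def maximal_subgroup_def)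
  then have "subgroup_Inter G S = {\<one>} \<longleftrightarrow> (\<forall>g\<in>subgroup_Inter G S. g = \<one>)" by blast
  also have "\<dots> \<longleftrightarrow> (\<forall>j i. (\<forall>M\<in>S. e j i \<in> M) \<longrightarrow> e j i = \<one>)"
    by (auto simp: subgroup_Inter_def carrier_eq)
  finally show ?thesis .
qed

text \<open>Two stabilizers attain the value. The empty family yields the whole group, and a single
  maximal subgroup is nontrivial.\<close>

lemma intersection_number_eq: "intersection_number G = 2"
proof (rule antisym)
  have "stabilizer 0 \<noteq> stabilizer 1"
    using stabilizer_0_Int_1 stabilizer_nontrivial[of 0] by auto
  then have "card {stabilizer 0, stabilizer 1} = 2" by simp
  moreover have "subgroup_Inter G {stabilizer 0, stabilizer 1} = frattini G"
    using stabilizer_0_Int_1 by (auto simp: subgroup_Inter_def frattini_eq)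
  ultimately have "enat 2 \<in> {enat (card S) | S. finite S \<and> (\<forall>M\<in>S. maximal_subgroup M G) \<and>
      subgroup_Inter G S = frattini G}"
    using maximal_stabilizer by (intro CollectI exI[of _ "{stabilizer 0, stabilizer 1}"]) auto
  then show "intersection_number G \<le> 2"
    unfolding intersection_number_def numeral_eq_enat by (rule Inf_lower)
next
  show "2 \<le> intersection_number G"
    unfolding intersection_number_def
  proof (rule Inf_greatest, clarify)
    fix S assume S: "finite S" "\<forall>M\<in>S. maximal_subgroup M G" "subgroup_Inter G S = frattini G"
    have "S \<noteq> {}"
    proof
      assume "S = {}"
      then have "carrier G = {\<one>}" using S(3) by (simp add: subgroup_Inter_def frattini_eq)
      then show False using stabilizer_nontrivial subgroup.subset[OF subgroup_stabilizer] by metis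
    qed
    moreover have "S \<noteq> {M}" for M
    proof
      assume "S = {M}"
      then have M: "maximal_subgroup M G" and "carrier G \<inter> M = {\<one>}"
        using S by (auto simp: subgroup_Inter_def frattini_eq)
      then show False
        using maximal_subgroup_nontrivial[OF M] subgroup.subset[of M G]
        by (auto simp: maximal_subgroup_def Int_absorb1)
    qed
    ultimately have "card S \<noteq> 0" "card S \<noteq> 1"
      using S(1) card_1_singletonE[of S] by auto
    then have "2 \<le> card S" by linarith
    then show "2 \<le> enat (card S)" by (simp add: numeral_eq_enat)
  qed
qed

text \<open>The family is determined up to the choice of \<open>t\<close>, so its size is forced and
  no separate minimality argument is needed.\<close>

lemma inconjugate_family_cases:
  assumes max: "\<forall>M\<in>S. maximal_subgroup M G"
    and inconj: "pairwise (\<lambda>H K. \<not> conjugate_subgroups G H K) S"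
    and inter: "subgroup_Inter G S = frattini G"
  obtains t where "S = insert (stabilizer t) (divisible_part ` prime_factors (p - 1))"
    and "squarefree (p - 1)"
proof -
  have trivial: "e j i = \<one>" if "\<And>M. M \<in> S \<Longrightarrow> e j i \<in> M" for j i
    using inter subgroup_Inter_eq_one_iff[of S] max that by (auto simp: frattini_eq)
  have "\<exists>t. stabilizer t \<in> S"
  proof (rule ccontr)
    assume no: "\<nexists>t. stabilizer t \<in> S"
    \<comment> \<open>Without a stabilizer, x would lie in every member.\<close>
    have "e 0 1 \<in> M" if M: "M \<in> S" for M
    proof -
      have "maximal_subgroup M G" using max M by blast
      then show ?thesis
        by (cases rule: maximal_subgroup_cases) (use no M in \<open>auto simp: divisible_part_def\<close>)
    qed
    then have "e 0 1 = \<one>" by (rule trivial)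
    then show False using p_ge by (simp add: e_eq_one_iff)
  qed
  then obtain t where t: "stabilizer t \<in> S" ..
  have p1: "p - 1 \<noteq> 0" using p_ge by simp
  define Q where "Q = {q \<in> prime_factors (p - 1). divisible_part q \<in> S}"
  have Q: "prime q" "q dvd p - 1" if "q \<in> Q" for q
    using that by (auto simp: Q_def)
  have "finite Q" by (simp add: Q_def)
  have sub: "M = stabilizer t \<or> (\<exists>q\<in>Q. M = divisible_part q)" if M: "M \<in> S" for M
  proof -
    have "maximal_subgroup M G" using max M by blast
    then show ?thesis
    proof (cases rule: maximal_subgroup_cases)
      \<comment> \<open>A second stabilizer would be conjugate to the first.\<close>
      case (1 s)
      then show ?thesis
        using inconj M t conjugate_stabilizers[of s t] by (auto simp: pairwise_def)
    next
      case (2 q)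
      then show ?thesis using M p1 by (auto simp: Q_def in_prime_factors_iff)
    qed
  qed
  then have S: "S = insert (stabilizer t) (divisible_part ` Q)"
    using t by (auto simp: Q_def)
  \<comment> \<open>Test element: its exponent of y is divisible by every prime in \<open>Q\<close>,
    and its translation part makes it fix \<open>t\<close>. It lies in every member, so it is
    trivial and \<open>p - 1\<close> divides the product of \<open>Q\<close>.\<close>
  define j where "j = \<Prod>Q"
  have "e j (t + (p - 1) * (r ^ j * t)) \<in> M" if "M \<in> S" for M
    using sub[OF that] e_mem_stabilizer_exists[of j t] Q \<open>finite Q\<close>
    by (auto simp: e_mem_divisible_part j_def dvd_prodI[of Q _ "\<lambda>q. q"])
  then have "e j (t + (p - 1) * (r ^ j * t)) = \<one>" by (rule trivial)
  then have dvd: "p - 1 dvd j" by (simp only: e_eq_one_iff)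
  have "squarefree j"
    unfolding j_def using Q by (intro squarefree_prod_coprime) (auto intro: primes_coprime squarefree_prime)
  then have "squarefree (p - 1)" using dvd squarefree_mono by blast
  moreover have "Q = prime_factors (p - 1)"
  proof
    show "prime_factors (p - 1) \<subseteq> Q"
    proof
      fix q assume "q \<in> prime_factors (p - 1)"
      then have "prime q" "q dvd p - 1" by auto
      with dvd have q: "prime q" "q dvd j" by (auto intro: dvd_trans[of q "p - 1" j])
      then obtain q' where q': "q' \<in> Q" "q dvd q'"
        unfolding j_def using prime_dvd_prod_iff[OF \<open>finite Q\<close> q(1), of "\<lambda>x. x"] by auto
      then have "q = q'" using primes_dvd_imp_eq[OF q(1) Q(1)] by simp
      then show "q \<in> Q" using q' by simp
    qed
  qed (auto simp: Q_def)
  ultimately show ?thesis using that S by blast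
qed

text \<open>An element of the intersection fixes 0, so its translation part vanishes; its exponent
  of y is divisible by each prime factor of \<open>p - 1\<close>, hence by the square-free
  \<open>p - 1\<close>.\<close>

lemma inconjugate_family:
  assumes sf: "squarefree (p - 1)"
  defines "S \<equiv> insert (stabilizer 0) (divisible_part ` prime_factors (p - 1))"
  shows "\<forall>M\<in>S. maximal_subgroup M G"
    and "pairwise (\<lambda>H K. \<not> conjugate_subgroups G H K) S"
    and "subgroup_Inter G S = frattini G"
proof -
  have pf: "prime q" "q dvd p - 1" if "q \<in> prime_factors (p - 1)" for q
    using that by auto
  show max: "\<forall>M\<in>S. maximal_subgroup M G"
    using maximal_stabilizer maximal_divisible_part pf by (auto simp: S_def)
  show "pairwise (\<lambda>H K. \<not> conjugate_subgroups G H K) S"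
  proof (rule pairwiseI)
    fix H K assume "H \<in> S" "K \<in> S" "H \<noteq> K"
    then have "(\<exists>q\<in>prime_factors (p - 1). H = divisible_part q \<or> K = divisible_part q)"
      by (auto simp: S_def)
    then show "\<not> conjugate_subgroups G H K"
      using conjugate_divisible_part pf max \<open>H \<in> S\<close> \<open>K \<in> S\<close> \<open>H \<noteq> K\<close> by metis
  qed
  have "e j i = \<one>" if *: "\<forall>M\<in>S. e j i \<in> M" for j i
  proof -
    have "q dvd j" if "q \<in> prime_factors (p - 1)" for q
      using * that pf by (auto simp: S_def e_mem_divisible_part)
    then have "p - 1 dvd j" using squarefree_dvdI[OF sf] by blast
    moreover have "p dvd i" using * by (auto simp: S_def e_mem_stabilizer cong_0_iff)
    ultimately show ?thesis by (simp only: e_eq_one_iff)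
  qed
  then show "subgroup_Inter G S = frattini G"
    using subgroup_Inter_eq_one_iff[of S] max by (auto simp: frattini_eq)
qed

lemma inconjugate_intersection_number_eq:
  "inconjugate_intersection_number G =
    (if squarefree (p - 1) then enat (card (prime_factors (p - 1)) + 1) else \<infinity>)"
proof -
  let ?A = "{enat (card S) | S. finite S \<and> (\<forall>M\<in>S. maximal_subgroup M G) \<and>
      pairwise (\<lambda>H K. \<not> conjugate_subgroups G H K) S \<and> subgroup_Inter G S = frattini G}"
  have card: "card (insert (stabilizer t) (divisible_part ` prime_factors (p - 1))) =
      card (prime_factors (p - 1)) + 1" for t
  proof -
    have "stabilizer t \<notin> divisible_part ` prime_factors (p - 1)"
      using divisible_part_neq_stabilizer by (metis imageE)
    then show ?thesis using card_image[OF inj_on_divisible_part] by simp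
  qed
  \<comment> \<open>All admissible families have the same size, so the infimum is over a singleton
    or over the empty set, where it is \<infinity>.\<close>
  have "?A = (if squarefree (p - 1) then {enat (card (prime_factors (p - 1)) + 1)} else {})"
  proof (cases "squarefree (p - 1)")
    case True
    have "enat (card (prime_factors (p - 1)) + 1) \<in> ?A"
      using inconjugate_family[OF True] card[of 0]
      by (intro CollectI exI[of _ "insert (stabilizer 0) (divisible_part ` prime_factors (p - 1))"]) simp
    moreover have "?A \<subseteq> {enat (card (prime_factors (p - 1)) + 1)}"
      using card by (auto elim!: inconjugate_family_cases)
    ultimately show ?thesis using True by auto
  next
    case False
    then have "?A = {}" by (blast elim: inconjugate_family_cases)
    then show ?thesis using False by simp
  qed
  then show ?thesis
    unfolding inconjugate_intersection_number_def
    by (cases "squarefree (p - 1)") (simp_all only: if_True if_False cInf_singleton Inf_empty top_enat_def)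
qed

end

section \<open>Coordinates on the presented group\<close>

text \<open>Moving a power of x past one y multiplies its exponent by \<open>r\<close>; this is
  iterated \<open>j\<close> times.\<close>

lemma (in group) pow_mult_pow_conj:
  assumes "x \<in> carrier G" "y \<in> carrier G" "x \<otimes> y = y \<otimes> x [^] (r::nat)"
  shows "x [^] (i::nat) \<otimes> y [^] (j::nat) = y [^] j \<otimes> x [^] (r ^ j * i)"
proof -
  have 1: "x [^] i \<otimes> y = y \<otimes> x [^] (r * i)" for i :: nat
  proof (induction i)
    case (Suc i)
    have "x [^] Suc i \<otimes> y = x [^] i \<otimes> (x \<otimes> y)" using assms by (simp add: m_assoc)
    also have "\<dots> = (x [^] i \<otimes> y) \<otimes> x [^] r" using assms by (simp add: m_assoc)
    also have "\<dots> = y \<otimes> (x [^] (r * i) \<otimes> x [^] r)" using assms Suc by (simp add: m_assoc)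
    also have "\<dots> = y \<otimes> x [^] (r * Suc i)" using assms by (simp add: nat_pow_mult add.commute)
    finally show ?case .
  qed (use assms in simp)
  show ?thesis
  proof (induction j)
    case (Suc j)
    have "x [^] i \<otimes> y [^] Suc j = (x [^] i \<otimes> y [^] j) \<otimes> y" using assms by (simp add: m_assoc)
    also have "\<dots> = y [^] j \<otimes> (x [^] (r ^ j * i) \<otimes> y)" using assms Suc by (simp add: m_assoc)
    also have "\<dots> = y [^] Suc j \<otimes> x [^] (r ^ Suc j * i)"
      using assms by (simp add: 1 m_assoc mult.assoc)
    finally show ?case .
  qed (use assms in simp)
qed

text \<open>
  \<open>s\<close> is an inverse of \<open>r\<close> modulo \<open>p\<close>; the letters of a word act one after the other, from left
  to right.
\<close>

fun letter_action :: "int \<Rightarrow> int \<Rightarrow> frobenius_gen \<times> bool \<Rightarrow> int \<Rightarrow> int" where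
  "letter_action r s (Gen_x, b) t = (if b then t + 1 else t - 1)"
| "letter_action r s (Gen_y, b) t = (if b then r * t else s * t)"

lemma letter_action_cong:
  assumes "[t = t'] (mod m)" shows "[letter_action r s l t = letter_action r s l t'] (mod m)"
  using assms by (cases "(r, s, l, t)" rule: letter_action.cases) (auto intro: cong_add cong_diff cong_mult)

lemma fold_letter_action_cong:
  assumes "[t = t'] (mod m)"
  shows "[fold (letter_action r s) w t = fold (letter_action r s) w t'] (mod m)"
  using assms by (induction w arbitrary: t t') (auto intro: letter_action_cong)

lemma fold_replicate_x: "fold (letter_action r s) (replicate k (Gen_x, True)) t = t + int k"
  by (induction k arbitrary: t) auto

lemma fold_replicate_y: "fold (letter_action r s) (replicate k (Gen_y, True)) t = r ^ k * t"
  by (induction k arbitrary: t) (auto simp: mult_ac)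

text \<open>Equal words act equally modulo \<open>m\<close>, so the action can separate elements of
  the presented group. Cancellation of y with its inverse is where \<open>s\<close> must invert
  \<open>r\<close>.\<close>

lemma word_eq_action:
  assumes "word_eq R u v" and s: "[r * s = 1] (mod m)"
    and rel: "\<And>u v t. (u, v) \<in> R \<Longrightarrow>
      [fold (letter_action r s) u t = fold (letter_action r s) v t] (mod m)"
  shows "[fold (letter_action r s) u t = fold (letter_action r s) v t] (mod m)"
  using assms(1)
proof (induction arbitrary: t rule: word_eq.induct)
  case (trans u v w)
  then show ?case using cong_trans by blast
next
  case (cancel a b)
  have "[r * s * t = 1 * t] (mod m)" using s by (rule cong_scalar_right)
  then show ?case by (cases a; cases b) (simp_all add: mult_ac)
qed (auto intro: cong_sym rel fold_letter_action_cong)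

section \<open>Normal forms in the Frobenius group\<close>

locale frobenius_presentation =
  fixes p r :: nat
  assumes prime: "prime p" and ge: "p \<ge> 5" and coprime: "coprime p r" and ord: "ord p r = p - 1"
begin

definition rels :: "(frobenius_gen gword \<times> frobenius_gen gword) set" where
  "rels = {(replicate p (Gen_x, True), []),
      (replicate (p - 1) (Gen_y, True), []),
      ([(Gen_y, False), (Gen_x, True), (Gen_y, True)], replicate r (Gen_x, True))}"

definition cls :: "frobenius_gen gword \<Rightarrow> frobenius_gen gword set" where
  "cls u = word_rel rels `` {u}"

abbreviation normal_form :: "nat \<Rightarrow> nat \<Rightarrow> frobenius_gen gword" where
  "normal_form j i \<equiv> replicate j (Gen_y, True) @ replicate i (Gen_x, True)"

lemma power_r_cong_1: "[r ^ j = 1] (mod p) \<longleftrightarrow> p - 1 dvd j"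
  by (simp only: ord_divides ord)

lemma power_r_cong_iff: "[r ^ j = r ^ j'] (mod p) \<longleftrightarrow> [j = j'] (mod (p - 1))"
  using order_divides_expdiff[OF coprime] ord by simp

lemma frobenius_group_eq: "frobenius_group p r = presented_group rels"
  by (simp add: frobenius_group_def rels_def)

sublocale group "frobenius_group p r"
  unfolding frobenius_group_eq by (rule group_presented_group)

lemma cls_closed [simp]: "cls u \<in> carrier (frobenius_group p r)"
  by (auto simp: cls_def frobenius_group_eq presented_group_def intro: quotientI)

lemma cls_mult: "cls u \<otimes>\<^bsub>frobenius_group p r\<^esub> cls v = cls (u @ v)"
  by (simp add: cls_def frobenius_group_eq mult_presented_group)

lemma cls_Nil: "cls [] = \<one>\<^bsub>frobenius_group p r\<^esub>"
  by (simp add: cls_def frobenius_group_eq presented_group_def)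

lemma cls_eq_iff: "cls u = cls v \<longleftrightarrow> word_eq rels u v"
  using eq_equiv_class_iff[OF equiv_word_rel, of u v rels] by (simp add: cls_def word_rel_def)

lemma cls_replicate: "cls (replicate k a) = cls [a] [^]\<^bsub>frobenius_group p r\<^esub> k"
proof (induction k)
  case (Suc k)
  show ?case by (simp add: cls_mult replicate_append_same flip: Suc)
qed (simp add: cls_Nil)

lemma cls_relation: "(u, v) \<in> rels \<Longrightarrow> cls u = cls v"
  by (simp only: cls_eq_iff word_eq.relation)

lemma normal_form_eq:
  "cls (normal_form j i) = cls [(Gen_y, True)] [^]\<^bsub>frobenius_group p r\<^esub> j
    \<otimes>\<^bsub>frobenius_group p r\<^esub> cls [(Gen_x, True)] [^]\<^bsub>frobenius_group p r\<^esub> i"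
  by (simp only: cls_mult flip: cls_replicate)

text \<open>Multiplying the third relation by y from the left turns it into xy = yx^r, the
  hypothesis of \<open>pow_mult_pow_conj\<close>.\<close>

lemma normal_form_mult:
  "cls (normal_form j i) \<otimes>\<^bsub>frobenius_group p r\<^esub> cls (normal_form j' i') =
    cls (normal_form (j + j') (r ^ j' * i + i'))"
proof -
  let ?G = "frobenius_group p r" and ?x = "cls [(Gen_x, True)]" and ?y = "cls [(Gen_y, True)]"
    and ?y' = "cls [(Gen_y, False)]"
  have y': "?y \<otimes>\<^bsub>?G\<^esub> ?y' = \<one>\<^bsub>?G\<^esub>"
    using word_eq.cancel[of rels Gen_y True] by (simp add: cls_mult cls_eq_iff flip: cls_Nil)
  have "?y' \<otimes>\<^bsub>?G\<^esub> (?x \<otimes>\<^bsub>?G\<^esub> ?y) = ?x [^]\<^bsub>?G\<^esub> r"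
    using cls_relation[of "[(Gen_y, False), (Gen_x, True), (Gen_y, True)]" "replicate r (Gen_x, True)"]
    by (simp add: rels_def cls_mult flip: cls_replicate)
  then have "?y \<otimes>\<^bsub>?G\<^esub> ?x [^]\<^bsub>?G\<^esub> r = (?y \<otimes>\<^bsub>?G\<^esub> ?y') \<otimes>\<^bsub>?G\<^esub> (?x \<otimes>\<^bsub>?G\<^esub> ?y)"
    by (simp only: m_assoc m_closed cls_closed)
  then have "?x \<otimes>\<^bsub>?G\<^esub> ?y = ?y \<otimes>\<^bsub>?G\<^esub> ?x [^]\<^bsub>?G\<^esub> r"
    by (simp only: y' l_one m_closed cls_closed)
  note comm = pow_mult_pow_conj[OF cls_closed cls_closed this, of i j']
  have "cls (normal_form j i) \<otimes>\<^bsub>?G\<^esub> cls (normal_form j' i') =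
      ?y [^]\<^bsub>?G\<^esub> j \<otimes>\<^bsub>?G\<^esub> (?x [^]\<^bsub>?G\<^esub> i \<otimes>\<^bsub>?G\<^esub> ?y [^]\<^bsub>?G\<^esub> j') \<otimes>\<^bsub>?G\<^esub> ?x [^]\<^bsub>?G\<^esub> i'"
    by (simp only: normal_form_eq m_assoc m_closed nat_pow_closed cls_closed)
  also have "\<dots> = (?y [^]\<^bsub>?G\<^esub> j \<otimes>\<^bsub>?G\<^esub> ?y [^]\<^bsub>?G\<^esub> j') \<otimes>\<^bsub>?G\<^esub>
      (?x [^]\<^bsub>?G\<^esub> (r ^ j' * i) \<otimes>\<^bsub>?G\<^esub> ?x [^]\<^bsub>?G\<^esub> i')"
    by (simp only: comm m_assoc m_closed nat_pow_closed cls_closed)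
  finally show ?thesis by (simp only: nat_pow_mult cls_closed normal_form_eq)
qed

lemma normal_form_cong:
  assumes "[j = j'] (mod (p - 1))" "[i = i'] (mod p)"
  shows "cls (normal_form j i) = cls (normal_form j' i')"
proof -
  have pow_cong: "a [^]\<^bsub>frobenius_group p r\<^esub> k = a [^]\<^bsub>frobenius_group p r\<^esub> l"
    if "a \<in> carrier (frobenius_group p r)" "a [^]\<^bsub>frobenius_group p r\<^esub> m = \<one>\<^bsub>frobenius_group p r\<^esub>"
      "[k = l] (mod m)" for a and k l m :: nat
  proof -
    have "a [^]\<^bsub>frobenius_group p r\<^esub> k = a [^]\<^bsub>frobenius_group p r\<^esub> (k mod m)" for k
    proof -
      have "a [^]\<^bsub>frobenius_group p r\<^esub> (m * (k div m) + k mod m) = a [^]\<^bsub>frobenius_group p r\<^esub> (k mod m)"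
        using that(1,2) by (simp only: nat_pow_mult[symmetric] nat_pow_pow[symmetric] nat_pow_one l_one nat_pow_closed)
      then show ?thesis by simp
    qed
    then show ?thesis using that(3) by (metis cong_def)
  qed
  have "cls [(Gen_x, True)] [^]\<^bsub>frobenius_group p r\<^esub> p = \<one>\<^bsub>frobenius_group p r\<^esub>"
    "cls [(Gen_y, True)] [^]\<^bsub>frobenius_group p r\<^esub> (p - 1) = \<one>\<^bsub>frobenius_group p r\<^esub>"
    unfolding cls_replicate[symmetric] cls_Nil[symmetric] by (rule cls_relation; simp add: rels_def)+
  then show ?thesis
    using pow_cong[OF cls_closed _ assms(1)] pow_cong[OF cls_closed _ assms(2)]
    by (simp only: normal_form_eq)
qed

text \<open>The relations cause no further collapse: y^j x^i acts as t \<mapsto> r^j t + i, and this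
  map determines both residues.\<close>

lemma normal_form_inject:
  assumes "cls (normal_form j i) = cls (normal_form j' i')"
  shows "[j = j'] (mod (p - 1))" "[i = i'] (mod p)"
proof -
  obtain s where s: "[int r * s = 1] (mod int p)"
    using cong_solve_coprime_int[of "int r" "int p"] coprime by (auto simp: coprime_commute)
  let ?act = "fold (letter_action (int r) s)"
  have act: "?act (normal_form j i) t = int r ^ j * t + int i" for j i t
    by (simp only: fold_append o_apply fold_replicate_x fold_replicate_y)
  have "[int r ^ (p - 1) * t = 1 * t] (mod int p)" for t
    using power_r_cong_1[of "p - 1"] by (intro cong_scalar_right) (simp flip: of_nat_power cong_int_iff)
  moreover have "[s * (int r * t) = s * (int r * t)] (mod int p)" for t
    by simp
  \<comment> \<open>The third relation: y^-1 x y and x^r both send \<open>t\<close> to t +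
    r.\<close>
  moreover have "[int r * (s * t + 1) = t + int r] (mod int p)" for t
    using cong_add[OF cong_scalar_right[OF s, of t] cong_refl[of "int r"]] by (simp add: algebra_simps)
  ultimately have rel: "[?act u t = ?act v t] (mod int p)" if "(u, v) \<in> rels" for u v t
    using that by (auto simp: rels_def fold_replicate_x fold_replicate_y cong_def simp del: fold_replicate)
  have act_cong: "[int (r ^ j * t + i) = int (r ^ j' * t + i')] (mod int p)" for t :: nat
    using word_eq_action[OF _ s rel, where R = rels and u = "normal_form j i" and v = "normal_form j' i'" and t = "int t"]
      assms act by (simp add: cls_eq_iff)
  \<comment> \<open>The image of 0 gives \<open>i\<close>; the image of 1 then gives r^j, hence
    \<open>j\<close> modulo its order.\<close>
  from act_cong[of 0] show i: "[i = i'] (mod p)" by (simp only: cong_int_iff) simp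
  from act_cong[of 1] have "[r ^ j + i = r ^ j' + i'] (mod p)" by (simp only: cong_int_iff) simp
  moreover have "[r ^ j' + i = r ^ j' + i'] (mod p)" using i by (intro cong_add cong_refl)
  ultimately have "[r ^ j + i = r ^ j' + i] (mod p)" using cong_trans cong_sym by blast
  then have "[r ^ j = r ^ j'] (mod p)" by (simp add: cong_add_rcancel_nat)
  then show "[j = j'] (mod (p - 1))" by (simp only: power_r_cong_iff)
qed

lemma ex_normal_form: "\<exists>j i. cls w = cls (normal_form j i)"
proof (induction w)
  case Nil
  show ?case by (intro exI[of _ 0]) simp
next
  case (Cons l w)
  let ?G = "frobenius_group p r"
  \<comment> \<open>The generators have finite order, so inverse letters become positive powers:
    both sides are right inverses of the same generator.\<close>
  have inverse: "cls [(a, False)] = cls (replicate (m - 1) (a, True))"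
    if "(replicate m (a, True), []) \<in> rels" "m > 0" for a m
  proof -
    have "cls [(a, True)] \<otimes>\<^bsub>?G\<^esub> cls [(a, False)] = \<one>\<^bsub>?G\<^esub>"
      using word_eq.cancel[of rels a True] by (simp add: cls_mult cls_eq_iff flip: cls_Nil)
    moreover have "cls [(a, True)] \<otimes>\<^bsub>?G\<^esub> cls (replicate (m - 1) (a, True)) = \<one>\<^bsub>?G\<^esub>"
      using cls_relation[OF that(1)] that(2) by (cases m) (simp_all add: cls_mult cls_Nil)
    ultimately show ?thesis by (metis Units_eq Units_l_cancel cls_closed)
  qed
  have "\<exists>j i. cls [l] = cls (normal_form j i)"
  proof -
    obtain a b where l: "l = (a, b)" by (cases l)
    have "cls [(Gen_x, b)] = cls (normal_form 0 (if b then 1 else p - 1))"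
      using inverse[of p Gen_x] ge by (cases b) (simp_all add: rels_def)
    \<comment> \<open>The relation for y has exponent \<open>p - 1\<close>, so its inverse is the
      power p - 2.\<close>
    moreover have "cls [(Gen_y, b)] = cls (normal_form (if b then 1 else p - 1 - 1) 0)"
      using inverse[of "p - 1" Gen_y] ge by (cases b) (simp_all add: rels_def)
    ultimately show ?thesis unfolding l by (cases a) blast+
  qed
  with Cons obtain j i j' i' where "cls [l] = cls (normal_form j i)" "cls w = cls (normal_form j' i')"
    by blast
  then have "cls [l] \<otimes>\<^bsub>?G\<^esub> cls w = cls (normal_form (j + j') (r ^ j' * i + i'))"
    by (simp only: normal_form_mult)
  then show ?case by (auto simp: cls_mult)
qed

sublocale affine_coordinates "frobenius_group p r" p r "\<lambda>j i. cls (normal_form j i)"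
proof
  show "carrier (frobenius_group p r) = {cls (normal_form j i) |j i. True}" (is "_ = ?N")
  proof
    show "carrier (frobenius_group p r) \<subseteq> ?N"
    proof
      fix g assume "g \<in> carrier (frobenius_group p r)"
      then obtain w where "g = cls w"
        by (auto simp: cls_def frobenius_group_eq presented_group_def elim: quotientE)
      then show "g \<in> ?N" using ex_normal_form[of w] by auto
    qed
  qed auto
  show "cls (normal_form j i) = cls (normal_form j' i') \<longleftrightarrow>
      [j = j'] (mod (p - 1)) \<and> [i = i'] (mod p)" for j i j' i'
    using normal_form_cong normal_form_inject by blast
  show "p \<ge> 3" using ge by simp
qed (rule prime power_r_cong_1 normal_form_mult)+

end

theorem proposition5p3:
  fixes p r :: nat
  assumes "prime p" and "p \<ge> 5"
    and "coprime p r" and "ord p r = p - 1"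
  shows "intersection_number (frobenius_group p r) = 2 \<and>
    inconjugate_intersection_number (frobenius_group p r) =
      (if squarefree (p - 1) then enat (card (prime_factors (p - 1)) + 1) else \<infinity>)"
proof -
  interpret frobenius_presentation p r
    using assms by unfold_locales
  show ?thesis using intersection_number_eq inconjugate_intersection_number_eq by blast
qed

end
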